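(* The scalar linear time invariant system $X_{t+1}=\lambda X_t+BU_t+W_t$ can be mean square stabilized using a linear scheme over the non-orthogonal half-duplex network if $$\log(|\lambda|)<\frac14\max_{\substack{0<\beta\le1\\ P_r^i:\ \sum_iP_r^i\le P_R}}\left\{\log\left(1+\frac{2h^2\beta P_S}{N_d}\right)+\log\left(1+\frac{\tilde M(\beta,\{P_r^i\}_{i=1}^L)}{\tilde N(\beta,\{P_r^i\}_{i=1}^L)}\right)\right\},$$ where $$\tilde M(\beta,\{P_r^i\}_{i=1}^L)=\left(\sqrt{2h^2(1-\beta)P_S}+\sqrt{\frac{2\beta P_SN_d}{2h^2\beta P_S+N_d}}\left(\sum_{i=1}^{L}\sqrt{\frac{2h_i^2P_r^i}{2\beta P_S+N_r^i}}\right)\right)^2,$$ $$\tilde N(\beta,\{P_r^i\}_{i=1}^L)=\sum_{i=1}^{L}\frac{2h_i^2P_r^iN_r^i}{2\beta P_S+N_r^i}+N_d.$$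
   Context: Notation: $\mathbb N=\{0,1,2,\dots\}$, $X_{[0,t]}=(X_0,\dots,X_t)$, $\log$ is base 2. Plant (scalar): $X_{t+1}=\lambda X_t+BU_t+W_t$, $t\in\mathbb N$, $X_t,U_t,W_t\in\mathbb R$, $|\lambda|\ge1$, $B\neq0$. $X_0$ is a random variable with finite differential entropy and given variance; $\{W_t\}$ is a zero-mean white (i.i.d.) Gaussian sequence of given variance, independent of $X_0$. The system is mean square stabilized if there is a constant $M<\infty$ with $\mathbb E[X_t^2]<M$ for all $t$. Non-orthogonal half-duplex network: a state encoder, $L$ relays, and a remote controller. The encoder sends $S_{e,t}=f_t(X_{[0,t]},U_{[0,t-1]})$ with $\mathbb E[S_{e,t}^2]=2\beta P_S$ for $t$ odd (first phase) and $\mathbb E[S_{e,t}^2]=2(1-\beta)P_S$ for $t=2,4,6,\dots$ (second phase), where $0<\beta\le1$ is a design parameter. (A one-off initial transmission at $t=0$ with power $P_S$ is allowed.) Relay $i$ satisfies: - $t=1,3,5,\dots$: $Y^i_t=S_{e,t}+Z^i_{r,t}$, $S^i_{r,t}=0$; - $t=2,4,6,\dots$: $Y^i_t=0$, $S^i_{r,t}=g^i_t(Y^i_{[0,t-1]})$ with $\mathbb E[(S^i_{r,t})^2]=2P_r^i$, where $P_r^i\ge0$ and $\sum_{i=1}^LP_r^i\le P_R$. The controller receives $R_t=hS_{e,t}+\sum_{i=1}^Lh_iS^i_{r,t}+Z_{d,t}$, with channel gains $h,h_i\in\mathbb R$, and applies $U_t=\pi_t(R_{[0,t]})$. The noises $Z^i_{r,t}\sim\mathcal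 N(0,N_r^i)$ and $Z_{d,t}\sim\mathcal N(0,N_d)$ are mutually independent, white, and independent of $X_0$ and $\{W_t\}$. A linear scheme is one in which all policies $f_t,g^i_t,\pi_t$ are linear functions of their arguments. *)

theory Defs
  imports "HOL-Probability.Probability"
begin

text \<open>Time and relay indices are natural numbers; the relays are those with index \<open>i < L\<close>. A process
  is a map \<open>nat \<Rightarrow> 'a \<Rightarrow> real\<close> (time, then outcome), a family of relay processes a map
  \<open>nat \<Rightarrow> nat \<Rightarrow> 'a \<Rightarrow> real\<close> (relay, time, outcome). Variances are denoted by the parameters
  \<open>Nw\<close>, \<open>Nr i\<close>, \<open>Nd\<close>; the plant gain \<open>\<lambda>\<close> is written \<open>a\<close>, as \<open>\<lambda>\<close> is reserved syntax.\<close>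

text \<open>When it is finite, \<open>entropy\<close> of \<open>X\<close> over \<open>lborel\<close> (\<open>HOL-Probability.Information\<close>) equals
  \<open>- (\<integral>x. p x * log 2 (p x) \<partial>lborel)\<close>. As a Bochner integral it is a real number even when the
  integral diverges, so finiteness has to be stated as integrability.\<close>

definition finite_diff_entropy :: "'a measure \<Rightarrow> ('a \<Rightarrow> real) \<Rightarrow> bool" where
  "finite_diff_entropy M X \<longleftrightarrow>
     (\<exists>p :: real \<Rightarrow> real. (\<forall>x. 0 \<le> p x) \<and> distributed M lborel X (\<lambda>x. ennreal (p x)) \<and>
        integrable lborel (\<lambda>x. p x * log 2 (p x)))"

definition gaussian :: "'a measure \<Rightarrow> real \<Rightarrow> ('a \<Rightarrow> real) \<Rightarrow> bool" where
  "gaussian M N Z \<longleftrightarrow> distributed M lborel Z (\<lambda>x. ennreal (normal_density 0 (sqrt N) x))"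

text \<open>Index type of all primitive random variables, so that their joint independence can be
  expressed as independence of a single family.\<close>

datatype source = Initial | Plant nat | Relay nat nat | Dest nat

fun primitive ::
  "('a \<Rightarrow> real) \<Rightarrow> (nat \<Rightarrow> 'a \<Rightarrow> real) \<Rightarrow> (nat \<Rightarrow> nat \<Rightarrow> 'a \<Rightarrow> real) \<Rightarrow> (nat \<Rightarrow> 'a \<Rightarrow> real)
    \<Rightarrow> source \<Rightarrow> 'a \<Rightarrow> real" where
  "primitive X0 W Zr Zd Initial = X0"
| "primitive X0 W Zr Zd (Plant t) = W t"
| "primitive X0 W Zr Zd (Relay i t) = Zr i t"
| "primitive X0 W Zr Zd (Dest t) = Zd t"

definition sources :: "nat \<Rightarrow> source set" where
  "sources L = {Initial} \<union> range Plant \<union> {Relay i t | i t. i < L} \<union> range Dest"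

text \<open>The history \<open>V\<^sub>0, \<dots>, V\<^bsub>n-1\<^esub>\<close> of a process; \<open>V\<^bsub>[0,t]\<^esub>\<close> is \<open>hist V (Suc t)\<close> and
  \<open>V\<^bsub>[0,t-1]\<^esub>\<close> is \<open>hist V t\<close>.\<close>

definition hist :: "(nat \<Rightarrow> 'a \<Rightarrow> real) \<Rightarrow> nat \<Rightarrow> 'a \<Rightarrow> real list" where
  "hist V n \<omega> = map (\<lambda>s. V s \<omega>) [0..<n]"

text \<open>Policies: encoder \<open>f t x u\<close>, relays \<open>g i t y\<close>, controller \<open>\<pi> t r\<close>, applied to histories.\<close>

type_synonym encoder = "nat \<Rightarrow> real list \<Rightarrow> real list \<Rightarrow> real"
type_synonym relays = "nat \<Rightarrow> nat \<Rightarrow> real list \<Rightarrow> real"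
type_synonym controller = "nat \<Rightarrow> real list \<Rightarrow> real"

definition linear_form :: "nat \<Rightarrow> (real list \<Rightarrow> real) \<Rightarrow> bool" where
  "linear_form n \<phi> \<longleftrightarrow>
     (\<exists>c :: nat \<Rightarrow> real. \<forall>v. length v = n \<longrightarrow> \<phi> v = (\<Sum>s<n. c s * v ! s))"

definition linear_scheme :: "nat \<Rightarrow> encoder \<Rightarrow> relays \<Rightarrow> controller \<Rightarrow> bool" where
  "linear_scheme L f g \<pi> \<longleftrightarrow>
     (\<forall>t. \<exists>a b. linear_form (Suc t) a \<and> linear_form t b \<and>
        (\<forall>x u. length x = Suc t \<longrightarrow> length u = t \<longrightarrow> f t x u = a x + b u)) \<and>
     (\<forall>i<L. \<forall>t. linear_form t (g i t)) \<and>
     (\<forall>t. linear_form (Suc t) (\<pi> t))"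

text \<open>Plant, half-duplex network and policies in closed loop. At \<open>t = 0\<close> the relays neither
  listen nor transmit. Since every policy sees past data only, the primitive random variables and
  the policies determine \<open>X\<close>, \<open>U\<close>, \<open>Se\<close>, \<open>R\<close> and, for \<open>i < L\<close>, \<open>Y i\<close>, \<open>Sr i\<close> uniquely.\<close>

definition closed_loop ::
  "real \<Rightarrow> real \<Rightarrow> nat \<Rightarrow> real \<Rightarrow> (nat \<Rightarrow> real) \<Rightarrow>
   ('a \<Rightarrow> real) \<Rightarrow> (nat \<Rightarrow> 'a \<Rightarrow> real) \<Rightarrow> (nat \<Rightarrow> nat \<Rightarrow> 'a \<Rightarrow> real) \<Rightarrow> (nat \<Rightarrow> 'a \<Rightarrow> real) \<Rightarrow>
   encoder \<Rightarrow> relays \<Rightarrow> controller \<Rightarrow>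
   (nat \<Rightarrow> 'a \<Rightarrow> real) \<Rightarrow> (nat \<Rightarrow> 'a \<Rightarrow> real) \<Rightarrow> (nat \<Rightarrow> 'a \<Rightarrow> real) \<Rightarrow>
   (nat \<Rightarrow> nat \<Rightarrow> 'a \<Rightarrow> real) \<Rightarrow> (nat \<Rightarrow> nat \<Rightarrow> 'a \<Rightarrow> real) \<Rightarrow> (nat \<Rightarrow> 'a \<Rightarrow> real) \<Rightarrow> bool" where
  "closed_loop a B L h hr X0 W Zr Zd f g \<pi> X U Se Y Sr R \<longleftrightarrow>
     (\<forall>\<omega>. X 0 \<omega> = X0 \<omega>) \<and>
     (\<forall>t \<omega>. X (Suc t) \<omega> = a * X t \<omega> + B * U t \<omega> + W t \<omega>) \<and>
     (\<forall>t \<omega>. Se t \<omega> = f t (hist X (Suc t) \<omega>) (hist U t \<omega>)) \<and>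
     (\<forall>i<L. \<forall>t \<omega>. Y i t \<omega> = (if odd t then Se t \<omega> + Zr i t \<omega> else 0)) \<and>
     (\<forall>i<L. \<forall>t \<omega>. Sr i t \<omega> = (if even t \<and> 0 < t then g i t (hist (Y i) t \<omega>) else 0)) \<and>
     (\<forall>t \<omega>. R t \<omega> = h * Se t \<omega> + (\<Sum>i<L. hr i * Sr i t \<omega>) + Zd t \<omega>) \<and>
     (\<forall>t \<omega>. U t \<omega> = \<pi> t (hist R (Suc t) \<omega>))"

text \<open>The Bochner expectation of a non-integrable function is 0, hence the integrability conjunct.\<close>

definition has_power :: "'a measure \<Rightarrow> ('a \<Rightarrow> real) \<Rightarrow> real \<Rightarrow> bool" where
  "has_power M V q \<longleftrightarrow>
     integrable M (\<lambda>\<omega>. (V \<omega>)\<^sup>2) \<and> prob_space.expectation M (\<lambda>\<omega>. (V \<omega>)\<^sup>2) = q"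

text \<open>The transmission at \<open>t = 0\<close> is optional: power \<open>PS\<close>, or none.\<close>

definition power_constraints ::
  "'a measure \<Rightarrow> nat \<Rightarrow> real \<Rightarrow> real \<Rightarrow> (nat \<Rightarrow> real) \<Rightarrow>
   (nat \<Rightarrow> 'a \<Rightarrow> real) \<Rightarrow> (nat \<Rightarrow> nat \<Rightarrow> 'a \<Rightarrow> real) \<Rightarrow> bool" where
  "power_constraints M L PS \<beta> Pr Se Sr \<longleftrightarrow>
     (has_power M (Se 0) PS \<or> has_power M (Se 0) 0) \<and>
     (\<forall>t. odd t \<longrightarrow> has_power M (Se t) (2 * \<beta> * PS)) \<and>
     (\<forall>t. even t \<and> 0 < t \<longrightarrow> has_power M (Se t) (2 * (1 - \<beta>) * PS)) \<and>
     (\<forall>i<L. \<forall>t. even t \<and> 0 < t \<longrightarrow> has_power M (Sr i t) (2 * Pr i))"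

definition mean_square_stable :: "'a measure \<Rightarrow> (nat \<Rightarrow> 'a \<Rightarrow> real) \<Rightarrow> bool" where
  "mean_square_stable M X \<longleftrightarrow>
     (\<exists>K :: real. \<forall>t. integrable M (\<lambda>\<omega>. (X t \<omega>)\<^sup>2) \<and>
        prob_space.expectation M (\<lambda>\<omega>. (X t \<omega>)\<^sup>2) < K)"

definition allocations :: "nat \<Rightarrow> real \<Rightarrow> (real \<times> (nat \<Rightarrow> real)) set" where
  "allocations L PR =
     {(\<beta>, Pr). 0 < \<beta> \<and> \<beta> \<le> 1 \<and> (\<forall>i<L. 0 \<le> Pr i) \<and> (\<Sum>i<L. Pr i) \<le> PR}"

definition M_tilde ::
  "nat \<Rightarrow> real \<Rightarrow> (nat \<Rightarrow> real) \<Rightarrow> real \<Rightarrow> (nat \<Rightarrow> real) \<Rightarrow> real \<Rightarrow> real \<Rightarrow> (nat \<Rightarrow> real) \<Rightarrow> real" where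
  "M_tilde L h hr PS Nr Nd \<beta> Pr =
     (sqrt (2 * h\<^sup>2 * (1 - \<beta>) * PS) +
      sqrt (2 * \<beta> * PS * Nd / (2 * h\<^sup>2 * \<beta> * PS + Nd)) *
        (\<Sum>i<L. sqrt (2 * (hr i)\<^sup>2 * Pr i / (2 * \<beta> * PS + Nr i))))\<^sup>2"

definition N_tilde ::
  "nat \<Rightarrow> (nat \<Rightarrow> real) \<Rightarrow> real \<Rightarrow> (nat \<Rightarrow> real) \<Rightarrow> real \<Rightarrow> real \<Rightarrow> (nat \<Rightarrow> real) \<Rightarrow> real" where
  "N_tilde L hr PS Nr Nd \<beta> Pr =
     (\<Sum>i<L. 2 * (hr i)\<^sup>2 * Pr i * Nr i / (2 * \<beta> * PS + Nr i)) + Nd"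

end

theory Submission
  imports Defs
begin

text \<open>The scheme works on pairs of time steps. At an odd time the encoder sends the scaled state, of
  second moment \<open>v\<close>, and the controller cancels its estimate of the state; the estimation error \<open>e\<close>
  has second moment \<open>\<rho> v\<close> with \<open>1 / \<rho> = 1 + 2 h\<^sup>2 \<beta> P\<^sub>S / N\<^sub>d\<close>. At the following even time the
  encoder sends the new state \<open>a e + W\<close>, the relays forward what they heard, and the controller
  subtracts from its observation the part of the relayed signal it can predict. What remains is a
  coherent superposition of two copies of \<open>e\<close> in noise of power \<open>N\<close>, whose signal power tends to
  \<open>M\<close> as \<open>v\<close> grows, since the plant noise then becomes negligible relative to \<open>a e\<close>. Hence two
  steps multiply a large \<open>v\<close> by asymptotically \<open>a\<^sup>4 \<rho> N / (M + N)\<close>, which the rate condition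
  makes less than one, so \<open>v\<close> stays bounded. Only second moments matter: all signals are linear in
  pairwise orthogonal primitive variables.\<close>

section \<open>Second moments along the two-phase recursion\<close>

text \<open>Beyond some \<open>x0\<close> a step is at most \<open>\<mu> * x + C\<close> with
  \<open>\<mu> < 1\<close>, which preserves the bound \<open>K\<close> as soon as
  \<open>C \<le> (1 - \<mu>) * K\<close>. Below \<open>x0\<close> the crude bound \<open>Q\<close>
  on the factor suffices.\<close>

lemma contracting_at_infinity_imp_bounded:
  fixes v :: "nat \<Rightarrow> real" and q :: "real \<Rightarrow> real"
  assumes step: "\<And>n. v (Suc n) \<le> q (v n) * v n + C"
    and nonneg: "\<And>n. 0 \<le> v n" and "0 \<le> C"
    and q_le: "\<And>x. 0 \<le> x \<Longrightarrow> q x \<le> Q"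
    and lim: "(q \<longlongrightarrow> \<kappa>) at_top" and "\<kappa> < 1"
  shows "\<exists>K. \<forall>n. v n \<le> K"
proof -
  obtain r where r: "\<kappa> < r" "r < 1" using dense[OF \<open>\<kappa> < 1\<close>] by blast
  \<comment> \<open>The cut at 0 serves monotonicity of products: \<open>\<kappa>\<close>, and with
    it \<open>r\<close>, may be negative.\<close>
  define \<mu> where "\<mu> = max 0 r"
  have \<mu>: "0 \<le> \<mu>" "\<mu> < 1" using r by (auto simp: \<mu>_def)
  have "eventually (\<lambda>x. q x < r) at_top" using order_tendstoD(2)[OF lim r(1)] .
  then obtain x0 where x0: "\<And>x. x \<ge> x0 \<Longrightarrow> q x < r" by (auto simp: eventually_at_top_linorder)
  \<comment> \<open>One entry for each case: the start, a step from below \<open>x0\<close>, a step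
    from \<open>x0\<close> or above.\<close>
  define K where "K = max (v 0) (max (\<bar>Q\<bar> * \<bar>x0\<bar> + C) (C / (1 - \<mu>)))"
  have "v n \<le> K" for n
  proof (induction n)
    case 0
    show ?case by (simp add: K_def)
  next
    case (Suc n)
    show ?case
    proof (cases "v n \<ge> x0")
      case True
      have "q (v n) * v n \<le> \<mu> * K"
        using x0[OF True] nonneg[of n] Suc \<mu> by (intro mult_mono) (auto simp: \<mu>_def)
      moreover have "C / (1 - \<mu>) \<le> K" by (simp add: K_def)
      then have "C \<le> (1 - \<mu>) * K" using \<mu> by (simp add: field_simps)
      ultimately show ?thesis using step[of n] by (simp add: algebra_simps)
    next
      case False
      have "q (v n) * v n \<le> \<bar>Q\<bar> * \<bar>x0\<bar>"
        using q_le[OF nonneg[of n]] nonneg[of n] False by (intro mult_mono) auto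
      then show ?thesis using step[of n] by (simp add: K_def)
    qed
  qed
  then show ?thesis by blast
qed

locale two_phase_scheme =
  fixes a h PS Nw Nd \<beta> :: real and L :: nat and hr Nr Pr :: "nat \<Rightarrow> real"
  assumes a_ge: "1 \<le> \<bar>a\<bar>" and PS_nonneg: "0 \<le> PS" and Nw_pos: "0 < Nw" and Nd_pos: "0 < Nd"
    and Nr_pos: "i < L \<Longrightarrow> 0 < Nr i" and beta_pos: "0 < \<beta>" and beta_le: "\<beta> \<le> 1"
    and Pr_nonneg: "i < L \<Longrightarrow> 0 \<le> Pr i"
begin

text \<open>The argument \<open>v\<close> is the second moment of the state at the odd time and \<open>mid v\<close> the one at the
  next even time. The gains \<open>enc1\<close>, \<open>enc2\<close>, \<open>amp\<close> are fixed by the power constraints; the signs of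
  \<open>enc2\<close> and \<open>amp\<close> make the direct and all relayed contributions to \<open>sig\<close> add up. \<open>est1\<close> is the
  least-squares gain, and \<open>est2\<close> is the one obtained by disregarding the plant noise in the state
  that is being estimated.\<close>

definition obs where "obs = 2 * h\<^sup>2 * \<beta> * PS + Nd"
definition rho where "rho = Nd / obs"
definition enc1 where "enc1 v = sqrt (2 * \<beta> * PS / v)"
definition est1 where "est1 v = h * enc1 v * v / obs"
definition mid where "mid v = a\<^sup>2 * rho * v + Nw"
definition enc2 where
  "enc2 v = (if h * a < 0 then -1 else 1) * sqrt (2 * (1 - \<beta>) * PS / mid v)"
definition amp where
  "amp i = (if hr i < 0 then -1 else 1) * sqrt (2 * Pr i / (2 * \<beta> * PS + Nr i))"
definition relay_gain where "relay_gain = (\<Sum>i<L. hr i * amp i)"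
definition sig where "sig v = h * enc2 v * a + relay_gain * enc1 v"
definition noise where "noise = N_tilde L hr PS Nr Nd \<beta> Pr"
definition est2 where "est2 v = a * sig v * v * rho / ((sig v)\<^sup>2 * v * rho + noise)"
text \<open>An exact second moment, not a bound. The summands belong to the error \<open>e\<close>,
  to the plant noise inside the state being estimated, to the relayed and receiver noise, and to the
  new plant noise.\<close>

definition next_var where
  "next_var v = a\<^sup>2 * ((a - est2 v * sig v)\<^sup>2 * rho * v + (1 - est2 v * h * enc2 v)\<^sup>2 * Nw
      + (est2 v)\<^sup>2 * noise) + Nw"

lemma obs_pos: "0 < obs"
  using PS_nonneg Nd_pos beta_pos by (auto simp: obs_def intro!: add_nonneg_pos)

lemma rho_pos: "0 < rho" and rho_le: "rho \<le> 1"
  using obs_pos Nd_pos PS_nonneg beta_pos by (auto simp: rho_def obs_def)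

lemma relay_denom_pos: "i < L \<Longrightarrow> 0 < 2 * \<beta> * PS + Nr i"
  using Nr_pos[of i] PS_nonneg beta_pos by (auto intro!: add_nonneg_pos)

lemma mid_pos: "0 \<le> v \<Longrightarrow> 0 < mid v"
  using rho_pos Nw_pos by (auto simp: mid_def intro!: add_nonneg_pos)

lemma enc1_sq: "0 < v \<Longrightarrow> (enc1 v)\<^sup>2 * v = 2 * \<beta> * PS"
  using PS_nonneg beta_pos by (simp add: enc1_def)

lemma enc1_nonneg: "0 < v \<Longrightarrow> 0 \<le> enc1 v"
  using PS_nonneg beta_pos by (simp add: enc1_def)

lemma enc2_sq: "0 \<le> v \<Longrightarrow> (enc2 v)\<^sup>2 * mid v = 2 * (1 - \<beta>) * PS"
  using mid_pos[of v] PS_nonneg beta_le by (auto simp: enc2_def power_mult_distrib)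

lemma enc2_sign: "h * enc2 v * a = \<bar>h * a\<bar> * sqrt (2 * (1 - \<beta>) * PS / mid v)"
  by (simp add: enc2_def)

lemma enc2_sign_nonneg: "0 \<le> v \<Longrightarrow> 0 \<le> h * enc2 v * a"
  unfolding enc2_sign using mid_pos[of v] PS_nonneg beta_le by simp

lemma amp_sq: "i < L \<Longrightarrow> (amp i)\<^sup>2 * (2 * \<beta> * PS + Nr i) = 2 * Pr i"
  using relay_denom_pos[of i] Pr_nonneg[of i] by (simp add: amp_def power_mult_distrib)

lemma hr_amp: "hr i * amp i = sqrt (2 * (hr i)\<^sup>2 * Pr i / (2 * \<beta> * PS + Nr i))"
proof -
  have "2 * (hr i)\<^sup>2 * Pr i / (2 * \<beta> * PS + Nr i) = (hr i)\<^sup>2 * (2 * Pr i / (2 * \<beta> * PS + Nr i))"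
    by simp
  then show ?thesis by (simp add: amp_def real_sqrt_mult abs_if del: times_divide_eq_right)
qed

lemma relay_gain_eq: "relay_gain = (\<Sum>i<L. sqrt (2 * (hr i)\<^sup>2 * Pr i / (2 * \<beta> * PS + Nr i)))"
  by (simp add: relay_gain_def hr_amp)

lemma relay_gain_nonneg: "0 \<le> relay_gain"
  unfolding relay_gain_eq
  using relay_denom_pos Pr_nonneg by (intro sum_nonneg) (auto simp: less_imp_le)

lemma noise_eq: "noise = (\<Sum>i<L. (hr i * amp i)\<^sup>2 * Nr i) + Nd"
proof -
  have "(hr i * amp i)\<^sup>2 * Nr i = 2 * (hr i)\<^sup>2 * Pr i * Nr i / (2 * \<beta> * PS + Nr i)" if "i < L" for i
    unfolding hr_amp using relay_denom_pos[OF that] Pr_nonneg[OF that] by simp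
  then show ?thesis by (simp add: noise_def N_tilde_def)
qed

lemma noise_pos: "0 < noise"
  unfolding noise_eq using Nd_pos Nr_pos by (intro add_nonneg_pos sum_nonneg) (auto simp: less_imp_le)

text \<open>With \<open>R = h * enc1 v * X + Zd\<close>, the error \<open>X - est1 v * R\<close> is
  therefore \<open>rho * X - est1 v * Zd\<close>.\<close>

lemma one_minus_est1: "0 < v \<Longrightarrow> 1 - est1 v * h * enc1 v = rho"
proof -
  assume v: "0 < v"
  have "est1 v * h * enc1 v = h\<^sup>2 * ((enc1 v)\<^sup>2 * v) / obs"
    by (simp add: est1_def power2_eq_square)
  then show ?thesis unfolding enc1_sq[OF v] using obs_pos
    by (simp add: rho_def field_simps) (simp add: obs_def)
qed

text \<open>The left side is the second moment of \<open>rho * X - est1 v * Zd\<close> for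
  orthogonal \<open>X\<close> and \<open>Zd\<close>; its second term equals
  \<open>rho * (1 - rho) * v\<close>.\<close>

lemma est1_error: "0 < v \<Longrightarrow> rho\<^sup>2 * v + (est1 v)\<^sup>2 * Nd = rho * v"
proof -
  assume v: "0 < v"
  have "(est1 v)\<^sup>2 * Nd = h\<^sup>2 * ((enc1 v)\<^sup>2 * v) * v * Nd / obs\<^sup>2"
    by (simp add: est1_def power2_eq_square)
  also have "\<dots> = rho * (1 - rho) * v"
    unfolding enc1_sq[OF v] using obs_pos
    by (simp add: rho_def field_simps power2_eq_square) (simp add: obs_def algebra_simps power2_eq_square)
  finally show ?thesis by (simp add: power2_eq_square algebra_simps)
qed

lemma next_var_pos: "0 < v \<Longrightarrow> 0 < next_var v"
  unfolding next_var_def using rho_pos noise_pos Nw_pos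
  by (intro add_nonneg_pos mult_nonneg_nonneg add_nonneg_nonneg) auto

section \<open>Contraction factor of a pair of steps and its limit\<close>

definition contraction where
  "contraction v = a ^ 4 * rho * noise / ((sig v)\<^sup>2 * v * rho + noise)"

text \<open>For \<open>a * e\<close> observed in noise of power \<open>noise\<close>,
  \<open>est2\<close> is the least-squares gain, so the error has the usual form with signal power
  \<open>S\<close>. Ignoring the plant noise in the choice of the gain costs only a constant,
  because that noise is never amplified.\<close>

lemma next_var_le:
  assumes v: "0 < v"
  shows "next_var v \<le> contraction v * v + (a\<^sup>2 * Nw + Nw)"
proof -
  define S where "S = (sig v)\<^sup>2 * v * rho"
  have S: "0 \<le> S" using v rho_pos by (simp add: S_def)
  have SN: "0 < S + noise" using S noise_pos by linarith
  have c: "est2 v * sig v = a * S / (S + noise)"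
    by (simp add: est2_def S_def power2_eq_square mult_ac)
  have err: "a - est2 v * sig v = a * noise / (S + noise)"
    unfolding c using SN by (simp add: field_simps)
  have c2: "(est2 v)\<^sup>2 = a\<^sup>2 * S * (rho * v) / (S + noise)\<^sup>2"
    by (simp add: est2_def S_def power2_eq_square mult_ac)
  have "(a - est2 v * sig v)\<^sup>2 * rho * v + (est2 v)\<^sup>2 * noise
      = a\<^sup>2 * rho * v * (noise * (S + noise)) / (S + noise)\<^sup>2"
    unfolding err c2 by (simp add: power_divide power_mult_distrib add_divide_distrib[symmetric])
      (simp add: power2_eq_square algebra_simps)
  also have "\<dots> = a\<^sup>2 * rho * v * noise / (S + noise)"
    using SN by (simp add: power2_eq_square)
  finally have mse: "(a - est2 v * sig v)\<^sup>2 * rho * v + (est2 v)\<^sup>2 * noise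
      = a\<^sup>2 * rho * v * noise / (S + noise)" .
  \<comment> \<open>\<open>p\<close> is the share of the plant noise removed by the estimate. The
    direct part of \<open>sig v\<close> lies between 0 and \<open>sig v\<close> since all
    contributions add coherently; this yields \<open>0 \<le> p\<close> and
    \<open>p \<le> 1\<close>.\<close>
  define p where "p = est2 v * h * enc2 v"
  have part: "0 \<le> h * enc2 v * a" "h * enc2 v * a \<le> sig v"
    using enc2_sign_nonneg[of v] v relay_gain_nonneg enc1_nonneg[OF v] by (auto simp: sig_def)
  have p_eq: "p = (h * enc2 v * a) * (sig v * v * rho) / (S + noise)"
    by (simp add: p_def est2_def S_def mult_ac)
  have "(h * enc2 v * a) * (sig v * v * rho) \<le> sig v * (sig v * v * rho)"
    using part v rho_pos by (intro mult_right_mono) auto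
  also have "\<dots> = S" by (simp add: S_def power2_eq_square mult_ac)
  finally have "p \<le> 1" unfolding p_eq using SN noise_pos by (simp add: field_simps)
  moreover have "0 \<le> p" unfolding p_eq using part v rho_pos SN by simp
  ultimately have "(1 - p)\<^sup>2 * Nw \<le> 1 * Nw"
    using Nw_pos by (intro mult_right_mono) (auto simp: power_le_one)
  then have "a\<^sup>2 * ((a\<^sup>2 * rho * v * noise / (S + noise)) + (1 - p)\<^sup>2 * Nw)
      \<le> a\<^sup>2 * ((a\<^sup>2 * rho * v * noise / (S + noise)) + Nw)"
    by (intro mult_left_mono) auto
  moreover have "next_var v = a\<^sup>2 * ((a\<^sup>2 * rho * v * noise / (S + noise)) + (1 - p)\<^sup>2 * Nw) + Nw"
    unfolding next_var_def mse[symmetric] p_def by (simp add: algebra_simps)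
  moreover have "contraction v * v = a\<^sup>2 * (a\<^sup>2 * rho * v * noise / (S + noise))"
    by (simp add: contraction_def S_def eval_nat_numeral mult_ac)
  ultimately show ?thesis by (simp add: distrib_left)
qed

text \<open>Controls the range of small \<open>v\<close>, about which the limit at infinity says
  nothing.\<close>

lemma contraction_le: "0 \<le> v \<Longrightarrow> contraction v \<le> a ^ 4"
proof -
  assume v: "0 \<le> v"
  have "a ^ 4 * (rho * noise) \<le> a ^ 4 * ((sig v)\<^sup>2 * v * rho + noise)"
    using rho_le rho_pos noise_pos v
    by (intro mult_left_mono) (auto intro!: add_increasing simp: mult_left_le_one_le)
  moreover have "0 < (sig v)\<^sup>2 * v * rho + noise"
    using rho_pos noise_pos v by (intro add_nonneg_pos) auto
  ultimately show ?thesis by (simp add: contraction_def field_simps)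
qed

text \<open>Since \<open>(enc1 v)\<^sup>2 * v\<close> is constant, the relayed part does not vary
  with \<open>v\<close>. The direct part varies only through the share
  \<open>a\<^sup>2 * rho * v / mid v\<close> of the even-time state power that stems from
  \<open>e\<close>, which tends to 1.\<close>

lemma sig_tendsto: "((\<lambda>v. (sig v)\<^sup>2 * v * rho) \<longlongrightarrow> M_tilde L h hr PS Nr Nd \<beta> Pr) at_top"
proof -
  \<comment> \<open>The same signal power for \<open>v > 0\<close>, rewritten so that
    \<open>v\<close> occurs only in that ratio.\<close>
  define f where "f v = (\<bar>h\<bar> * sqrt (2 * (1 - \<beta>) * PS) * sqrt (a\<^sup>2 * rho * v / mid v)
     + relay_gain * sqrt (2 * \<beta> * PS * rho))\<^sup>2" for v
  have a0: "a\<^sup>2 * rho > 0" using a_ge rho_pos by auto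
  have "((\<lambda>v. 1 - Nw / mid v) \<longlongrightarrow> 1 - 0) at_top"
  proof (intro tendsto_diff tendsto_const tendsto_divide_0[OF tendsto_const])
    have "filterlim mid at_top at_top" unfolding mid_def
      by (subst add.commute)
        (intro filterlim_tendsto_add_at_top[OF tendsto_const]
          filterlim_tendsto_pos_mult_at_top[OF tendsto_const a0 filterlim_ident])
    then show "filterlim mid at_infinity at_top" by (rule filterlim_at_top_imp_at_infinity)
  qed
  moreover have "eventually (\<lambda>v. 1 - Nw / mid v = a\<^sup>2 * rho * v / mid v) at_top"
    using eventually_gt_at_top[of 0]
  proof eventually_elim
    case (elim v)
    then show ?case using mid_pos[of v] by (simp add: field_simps) (simp add: mid_def)
  qed
  ultimately have "((\<lambda>v. a\<^sup>2 * rho * v / mid v) \<longlongrightarrow> 1) at_top"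
    by (simp add: tendsto_cong)
  then have "(f \<longlongrightarrow> (\<bar>h\<bar> * sqrt (2 * (1 - \<beta>) * PS) * sqrt 1
     + relay_gain * sqrt (2 * \<beta> * PS * rho))\<^sup>2) at_top"
    unfolding f_def by (intro tendsto_intros)
  also have "(\<bar>h\<bar> * sqrt (2 * (1 - \<beta>) * PS) * sqrt 1 + relay_gain * sqrt (2 * \<beta> * PS * rho))\<^sup>2
      = M_tilde L h hr PS Nr Nd \<beta> Pr"
  proof -
    have "sqrt (2 * h\<^sup>2 * (1 - \<beta>) * PS) = \<bar>h\<bar> * sqrt (2 * (1 - \<beta>) * PS)"
      unfolding real_sqrt_abs[symmetric] real_sqrt_mult[symmetric] by (simp add: mult_ac)
    then show ?thesis
      unfolding M_tilde_def relay_gain_eq rho_def obs_def by (simp add: mult.commute)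
  qed
  finally have "(f \<longlongrightarrow> M_tilde L h hr PS Nr Nd \<beta> Pr) at_top" .
  moreover have "eventually (\<lambda>v. f v = (sig v)\<^sup>2 * v * rho) at_top"
    using eventually_gt_at_top[of 0]
  proof eventually_elim
    case (elim v)
    have r: "\<bar>h * a\<bar> * sqrt (2 * (1 - \<beta>) * PS / mid v) * sqrt (v * rho)
        = \<bar>h\<bar> * sqrt (2 * (1 - \<beta>) * PS) * sqrt (a\<^sup>2 * rho * v / mid v)"
      by (simp add: abs_mult real_sqrt_mult real_sqrt_divide)
    have "enc1 v * sqrt (v * rho) = sqrt (2 * \<beta> * PS * rho)"
      unfolding enc1_def real_sqrt_mult[symmetric] using elim by simp
    moreover have "sig v * sqrt (v * rho)
        = (h * enc2 v * a) * sqrt (v * rho) + relay_gain * (enc1 v * sqrt (v * rho))"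
      by (simp add: sig_def algebra_simps)
    ultimately have "sig v * sqrt (v * rho) = \<bar>h\<bar> * sqrt (2 * (1 - \<beta>) * PS) * sqrt (a\<^sup>2 * rho * v / mid v)
        + relay_gain * sqrt (2 * \<beta> * PS * rho)"
      by (simp only: enc2_sign r)
    then have "f v = (sig v * sqrt (v * rho))\<^sup>2" by (simp add: f_def)
    also have "\<dots> = (sig v)\<^sup>2 * v * rho" using elim rho_pos by (simp add: power_mult_distrib)
    finally show ?case .
  qed
  ultimately show ?thesis by (rule Lim_transform_eventually)
qed

text \<open>Exponentiating turns the two logarithms into the product of \<open>1 / rho\<close> and
  \<open>(M + noise) / noise\<close>, with \<open>M\<close> the limiting signal power. The factor
  \<open>1 / 4\<close> becomes the exponent of \<open>\<bar>a\<bar> ^ 4\<close>: two steps, each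
  multiplying powers by \<open>a\<^sup>2\<close>.\<close>

lemma contraction_limit_less_one:
  assumes "log 2 \<bar>a\<bar> < 1 / 4 * (log 2 (1 + 2 * h\<^sup>2 * \<beta> * PS / Nd) +
     log 2 (1 + M_tilde L h hr PS Nr Nd \<beta> Pr / N_tilde L hr PS Nr Nd \<beta> Pr))"
  shows "a ^ 4 * rho * noise / (M_tilde L h hr PS Nr Nd \<beta> Pr + noise) < 1"
proof -
  let ?M = "M_tilde L h hr PS Nr Nd \<beta> Pr"
  have M: "0 \<le> ?M" by (simp add: M_tilde_def)
  have e1: "1 + 2 * h\<^sup>2 * \<beta> * PS / Nd = 1 / rho"
    using Nd_pos by (simp add: rho_def obs_def field_simps)
  have e2: "1 + ?M / noise = (?M + noise) / noise" using noise_pos by (simp add: field_simps)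
  have pos: "0 < 1 / rho" "0 < (?M + noise) / noise" using rho_pos noise_pos M by auto
  have "log 2 (\<bar>a\<bar> ^ 4) = 4 * log 2 \<bar>a\<bar>" using a_ge by (subst log_nat_power) auto
  also have "\<dots> < log 2 (1 / rho) + log 2 ((?M + noise) / noise)"
    using assms unfolding noise_def[symmetric] e1 e2 by simp
  also have "\<dots> = log 2 (1 / rho * ((?M + noise) / noise))"
    using pos by (subst log_mult) auto
  finally have "log 2 (\<bar>a\<bar> ^ 4) < log 2 (1 / rho * ((?M + noise) / noise))" .
  then have "\<bar>a\<bar> ^ 4 < 1 / rho * ((?M + noise) / noise)"
    using mult_pos_pos[OF pos] a_ge by (subst (asm) log_less_cancel_iff) auto
  then show ?thesis using rho_pos noise_pos M by (simp add: field_simps)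
qed

text \<open>Index \<open>n\<close> stands for time \<open>2 * n + 1\<close>.\<close>

primrec var_seq :: "real \<Rightarrow> nat \<Rightarrow> real" where
  "var_seq v 0 = v"
| "var_seq v (Suc n) = next_var (var_seq v n)"

lemma var_seq_pos: "0 < v \<Longrightarrow> 0 < var_seq v n"
  by (induction n) (auto intro: next_var_pos)

lemma var_seq_bounded:
  assumes "0 < v" and "log 2 \<bar>a\<bar> < 1 / 4 * (log 2 (1 + 2 * h\<^sup>2 * \<beta> * PS / Nd) +
     log 2 (1 + M_tilde L h hr PS Nr Nd \<beta> Pr / N_tilde L hr PS Nr Nd \<beta> Pr))"
  shows "\<exists>K. \<forall>n. var_seq v n \<le> K"
proof (rule contracting_at_infinity_imp_bounded)
  show "var_seq v (Suc n) \<le> contraction (var_seq v n) * var_seq v n + (a\<^sup>2 * Nw + Nw)" for n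
    using next_var_le[OF var_seq_pos[OF \<open>0 < v\<close>]] by simp
  show "0 \<le> var_seq v n" for n using var_seq_pos[OF \<open>0 < v\<close>] less_imp_le by blast
  show "0 \<le> a\<^sup>2 * Nw + Nw" using Nw_pos by simp
  have "M_tilde L h hr PS Nr Nd \<beta> Pr + noise \<noteq> 0"
    using noise_pos by (simp add: M_tilde_def add_nonneg_eq_0_iff)
  then show "(contraction \<longlongrightarrow> a ^ 4 * rho * noise / (M_tilde L h hr PS Nr Nd \<beta> Pr + noise)) at_top"
    unfolding contraction_def by (intro tendsto_intros sig_tendsto)
qed (use contraction_le contraction_limit_less_one[OF assms(2)] in auto)

end


section \<open>Orthogonal noise\<close>

lemma integrable_mult_square_integrable:
  fixes f g :: "'a \<Rightarrow> real"
  assumes [measurable]: "f \<in> borel_measurable M" "g \<in> borel_measurable M"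
    and "integrable M (\<lambda>x. (f x)\<^sup>2)" "integrable M (\<lambda>x. (g x)\<^sup>2)"
  shows "integrable M (\<lambda>x. f x * g x)"
proof (rule Bochner_Integration.integrable_bound)
  show "integrable M (\<lambda>x. (f x)\<^sup>2 + (g x)\<^sup>2)" using assms by simp
  have "\<bar>x * y\<bar> \<le> x\<^sup>2 + y\<^sup>2" for x y :: real
  proof -
    have "2 * (\<bar>x\<bar> * \<bar>y\<bar>) \<le> x\<^sup>2 + y\<^sup>2" using sum_squares_bound[of "\<bar>x\<bar>" "\<bar>y\<bar>"] by simp
    moreover have "0 \<le> \<bar>x\<bar> * \<bar>y\<bar>" by simp
    ultimately show ?thesis unfolding abs_mult by linarith
  qed
  then show "AE x in M. norm (f x * g x) \<le> norm ((f x)\<^sup>2 + (g x)\<^sup>2)" by auto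
qed simp

lemma has_power_scale: "has_power M V v \<Longrightarrow> has_power M (\<lambda>\<omega>. c * V \<omega>) (c\<^sup>2 * v)"
  by (auto simp: has_power_def power_mult_distrib)

locale orthogonal_noise = prob_space M for M :: "'a measure" +
  fixes \<xi> :: "'i \<Rightarrow> 'a \<Rightarrow> real" and N :: "'i \<Rightarrow> real" and A :: "'i set"
  assumes meas: "j \<in> A \<Longrightarrow> \<xi> j \<in> borel_measurable M"
    and power: "j \<in> A \<Longrightarrow> has_power M (\<xi> j) (N j)"
    and orth: "i \<in> A \<Longrightarrow> j \<in> A \<Longrightarrow> i \<noteq> j \<Longrightarrow> expectation (\<lambda>\<omega>. \<xi> i \<omega> * \<xi> j \<omega>) = 0"
begin

text \<open>\<open>J\<close> is the stock of noises still available to be added to \<open>V\<close>.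
  Orthogonality is taken without centering, so \<open>V\<close> may have a nonzero mean and
  \<open>v\<close> is a second moment rather than a variance.\<close>

definition uncorr :: "('a \<Rightarrow> real) \<Rightarrow> real \<Rightarrow> 'i set \<Rightarrow> bool" where
  "uncorr V v J \<longleftrightarrow> V \<in> borel_measurable M \<and> has_power M V v \<and> J \<subseteq> A \<and>
     (\<forall>j\<in>J. expectation (\<lambda>\<omega>. V \<omega> * \<xi> j \<omega>) = 0)"

lemma uncorr_has_power: "uncorr V v J \<Longrightarrow> has_power M V v"
  by (simp add: uncorr_def)

lemma uncorr_mono: "uncorr V v J \<Longrightarrow> K \<subseteq> J \<Longrightarrow> uncorr V v K"
  by (auto simp: uncorr_def)

lemma uncorr_scale: "uncorr V v J \<Longrightarrow> uncorr (\<lambda>\<omega>. c * V \<omega>) (c\<^sup>2 * v) J"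
  by (auto simp: uncorr_def mult.assoc intro: has_power_scale)

text \<open>The cross term vanishes because \<open>j\<close> is in \<open>J\<close>, and pairwise
  orthogonality of the noises preserves the rest of \<open>J\<close>. The index \<open>j\<close>
  leaves the stock, as the sum is in general correlated with \<open>\<xi> j\<close>.\<close>

lemma uncorr_add:
  assumes V: "uncorr V v J" and j: "j \<in> J"
  shows "uncorr (\<lambda>\<omega>. V \<omega> + c * \<xi> j \<omega>) (v + c\<^sup>2 * N j) (J - {j})"
proof -
  have [measurable]: "V \<in> borel_measurable M" and JA: "J \<subseteq> A" using V by (auto simp: uncorr_def)
  note meas[measurable]
  have sq: "integrable M (\<lambda>\<omega>. (\<xi> i \<omega>)\<^sup>2)" if "i \<in> A" for i
    using power[OF that] by (simp add: has_power_def)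
  have sqV: "integrable M (\<lambda>\<omega>. (V \<omega>)\<^sup>2)" using V by (simp add: uncorr_def has_power_def)
  have jA: "j \<in> A" using j JA by auto
  have VI: "integrable M (\<lambda>\<omega>. V \<omega> * \<xi> i \<omega>)" if "i \<in> A" for i
    using that by (intro integrable_mult_square_integrable sq sqV meas) auto
  have II: "integrable M (\<lambda>\<omega>. \<xi> j \<omega> * \<xi> i \<omega>)" if "i \<in> A" for i
    using that jA by (intro integrable_mult_square_integrable sq meas) auto
  have expand: "(V \<omega> + c * \<xi> j \<omega>)\<^sup>2 = (V \<omega>)\<^sup>2 + 2 * c * (V \<omega> * \<xi> j \<omega>) + c\<^sup>2 * (\<xi> j \<omega>)\<^sup>2" for \<omega>
    by (simp add: power2_eq_square algebra_simps)
  have "has_power M (\<lambda>\<omega>. V \<omega> + c * \<xi> j \<omega>) (v + c\<^sup>2 * N j)"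
    unfolding has_power_def expand
    using sqV VI[OF jA] sq[OF jA] V j power[OF jA] by (simp add: uncorr_def has_power_def)
  moreover have "expectation (\<lambda>\<omega>. (V \<omega> + c * \<xi> j \<omega>) * \<xi> i \<omega>) = 0" if "i \<in> J - {j}" for i
  proof -
    have iA: "i \<in> A" using that JA by auto
    have "expectation (\<lambda>\<omega>. (V \<omega> + c * \<xi> j \<omega>) * \<xi> i \<omega>)
        = expectation (\<lambda>\<omega>. V \<omega> * \<xi> i \<omega> + c * (\<xi> j \<omega> * \<xi> i \<omega>))"
      by (simp add: algebra_simps)
    also have "\<dots> = 0"
      using VI[OF iA] II[OF iA] V that orth[OF jA iA] by (auto simp: uncorr_def)
    finally show ?thesis .
  qed
  moreover have "(\<lambda>\<omega>. V \<omega> + c * \<xi> j \<omega>) \<in> borel_measurable M" using meas[OF jA] by simp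
  ultimately show ?thesis using JA by (auto simp: uncorr_def)
qed

lemma uncorr_sum:
  assumes "finite I" "inj_on f I" "f ` I \<subseteq> J" and V: "uncorr V v J"
  shows "uncorr (\<lambda>\<omega>. V \<omega> + (\<Sum>i\<in>I. c i * \<xi> (f i) \<omega>)) (v + (\<Sum>i\<in>I. (c i)\<^sup>2 * N (f i))) (J - f ` I)"
  using assms(1-3)
proof (induction I)
  case empty
  then show ?case using V by simp
next
  case (insert i I)
  have "uncorr (\<lambda>\<omega>. V \<omega> + (\<Sum>i\<in>I. c i * \<xi> (f i) \<omega>)) (v + (\<Sum>i\<in>I. (c i)\<^sup>2 * N (f i))) (J - f ` I)"
    using insert by auto
  moreover have "f i \<in> J - f ` I" using insert by auto
  ultimately have "uncorr (\<lambda>\<omega>. V \<omega> + (\<Sum>i\<in>I. c i * \<xi> (f i) \<omega>) + c i * \<xi> (f i) \<omega>)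
      (v + (\<Sum>i\<in>I. (c i)\<^sup>2 * N (f i)) + (c i)\<^sup>2 * N (f i)) (J - f ` I - {f i})"
    by (rule uncorr_add)
  moreover have "J - f ` I - {f i} = J - f ` insert i I" by auto
  ultimately show ?case using insert(1,2) by (simp add: add_ac)
qed

end

section \<open>Second moments of the primitive variables\<close>

fun source_var :: "real \<Rightarrow> real \<Rightarrow> (nat \<Rightarrow> real) \<Rightarrow> source \<Rightarrow> real" where
  "source_var Nw Nd Nr Initial = 0"
| "source_var Nw Nd Nr (Plant t) = Nw"
| "source_var Nw Nd Nr (Relay i t) = Nr i"
| "source_var Nw Nd Nr (Dest t) = Nd"

text \<open>The noises that cannot have influenced \<open>X t\<close>: anything drawn at time
  \<open>s\<close> reaches the state at \<open>s + 1\<close> at the earliest. \<open>X0\<close> is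
  instead the variable from which the argument starts, with arbitrary mean.\<close>

definition future :: "nat \<Rightarrow> nat \<Rightarrow> source set" where
  "future L t = {Plant s | s. t \<le> s} \<union> {Relay i s | i s. i < L \<and> t \<le> s} \<union> {Dest s | s. t \<le> s}"

lemma gaussian_second_order:
  assumes "prob_space M" "gaussian M v Z" "0 < v"
  shows "has_power M Z v" "prob_space.expectation M Z = 0" "integrable M Z"
proof -
  interpret prob_space M by fact
  have D: "distributed M lborel Z (normal_density 0 (sqrt v))" and s: "0 < sqrt v"
    using assms by (auto simp: gaussian_def)
  show E: "expectation Z = 0" by (rule normal_distributed_expectation[OF s D])
  have "expectation (\<lambda>\<omega>. (Z \<omega>)\<^sup>2) = v"
    using normal_distributed_variance[OF s D] E \<open>0 < v\<close> by simp
  moreover have "integrable M (\<lambda>\<omega>. (Z \<omega>)\<^sup>2)"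
    using distributed_integrable[OF D, of "\<lambda>x. x\<^sup>2"] integrable_normal_moment[OF s, of 0 2] by simp
  ultimately show "has_power M Z v" by (simp add: has_power_def)
  show "integrable M Z"
    using distributed_integrable[OF D, of "\<lambda>x. x"] integrable_normal_moment_nz_1[OF s, of 0] by simp
qed

text \<open>The expectation of the product factorizes. Centering one factor is enough, so
  \<open>i\<close> may be \<open>Initial\<close>.\<close>

lemma (in prob_space) indep_vars_orthogonal:
  assumes "indep_vars (\<lambda>_. borel) Z I" "i \<in> I" "j \<in> I" "i \<noteq> j"
    and "integrable M (Z i)" "integrable M (Z j :: _ \<Rightarrow> real)" "expectation (Z j) = 0"
  shows "expectation (\<lambda>\<omega>. Z i \<omega> * Z j \<omega>) = 0"
proof -
  have "indep_vars (\<lambda>_. borel) Z {i, j}" using assms by (intro indep_vars_subset[OF assms(1)]) auto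
  then have "expectation (\<lambda>\<omega>. \<Prod>k\<in>{i, j}. Z k \<omega>) = (\<Prod>k\<in>{i, j}. expectation (Z k))"
    using assms by (intro indep_vars_lebesgue_integral) auto
  then show ?thesis using assms by simp
qed

section \<open>The closed loop\<close>

lemma hist_nth [simp]: "s < n \<Longrightarrow> hist V n \<omega> ! s = V s \<omega>"
  by (simp add: hist_def)

text \<open>These policies look back at most one step, so the loop is a primitive recursion on a
  finite state. At \<open>t = 0\<close> truncated subtraction makes \<open>r ! (t - 1)\<close> the
  current observation, while the recursion stores 0 as the previous one; \<open>d 0 = 0\<close>
  reconciles the two.\<close>

lemma closed_loop_exists:
  fixes e c d \<gamma> :: "nat \<Rightarrow> real" and X0 :: "'a \<Rightarrow> real"
  assumes d0: "d 0 = 0"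
  shows "\<exists>X U Se Y Sr R.
    closed_loop a B L h hr X0 W Zr Zd (\<lambda>t x u. e t * x ! t)
      (\<lambda>i t y. if t = 0 then 0 else \<gamma> i * y ! (t - 1)) (\<lambda>t r. c t * r ! t + d t * r ! (t - 1))
      X U Se Y Sr R"
proof -
  \<comment> \<open>The components of the state at \<open>t\<close> are \<open>X\<^sub>t\<close>, \<open>R\<^bsub>t-1\<^esub>\<close> and \<open>S\<^bsub>e,t-1\<^esub>\<close>.\<close>
  define st where "st \<omega> = rec_nat (X0 \<omega>, 0, 0) (\<lambda>t (x, r, s).
     let s' = e t * x;
         r' = h * s' + (\<Sum>i<L. hr i *
            (if even t \<and> 0 < t then \<gamma> i * (s + Zr i (t - 1) \<omega>) else 0)) + Zd t \<omega>;
         u = c t * r' + d t * r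
     in (a * x + B * u + W t \<omega>, r', s'))" for \<omega>
  define X where "X t \<omega> = fst (st \<omega> t)" for t \<omega>
  define R where "R t \<omega> = fst (snd (st \<omega> (Suc t)))" for t \<omega>
  define Se where "Se t \<omega> = snd (snd (st \<omega> (Suc t)))" for t \<omega>
  define U where "U t \<omega> = c t * R t \<omega> + d t * R (t - 1) \<omega>" for t \<omega>
  define Y where "Y i t \<omega> = (if odd t then Se t \<omega> + Zr i t \<omega> else 0)" for i t \<omega>
  define Sr where "Sr i t \<omega> = (if even t \<and> 0 < t then \<gamma> i * Y i (t - 1) \<omega> else 0)" for i t \<omega>
  have st_Suc: "st \<omega> (Suc t) =
     (let s' = e t * fst (st \<omega> t);
          r' = h * s' + (\<Sum>i<L. hr i *
            (if even t \<and> 0 < t then \<gamma> i * (snd (snd (st \<omega> t)) + Zr i (t - 1) \<omega>) else 0)) + Zd t \<omega>;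
          u = c t * r' + d t * fst (snd (st \<omega> t))
      in (a * fst (st \<omega> t) + B * u + W t \<omega>, r', s'))" for t \<omega>
    by (simp add: st_def case_prod_beta Let_def cong: if_cong)
  have Se: "Se t \<omega> = e t * X t \<omega>" for t \<omega>
    by (simp add: Se_def X_def st_Suc Let_def)
  have R: "R t \<omega> = h * Se t \<omega> + (\<Sum>i<L. hr i * Sr i t \<omega>) + Zd t \<omega>" for t \<omega>
  proof -
    have "Sr i t \<omega> = (if even t \<and> 0 < t then \<gamma> i * (snd (snd (st \<omega> t)) + Zr i (t - 1) \<omega>) else 0)" for i
      by (cases t) (simp_all add: Sr_def Y_def Se_def)
    then show ?thesis by (simp only: R_def Se X_def) (simp add: st_Suc Let_def)
  qed
  have X: "X (Suc t) \<omega> = a * X t \<omega> + B * U t \<omega> + W t \<omega>" for t \<omega>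
  proof -
    have "X (Suc t) \<omega> = a * X t \<omega> + B * (c t * R t \<omega> + d t * fst (snd (st \<omega> t))) + W t \<omega>"
      by (simp add: X_def R_def st_Suc Let_def)
    then show ?thesis using d0 by (cases t) (auto simp: U_def R_def)
  qed
  have "closed_loop a B L h hr X0 W Zr Zd (\<lambda>t x u. e t * x ! t)
      (\<lambda>i t y. if t = 0 then 0 else \<gamma> i * y ! (t - 1)) (\<lambda>t r. c t * r ! t + d t * r ! (t - 1))
      X U Se Y Sr R"
    unfolding closed_loop_def
  proof (intro conjI allI impI)
    show "X 0 \<omega> = X0 \<omega>" for \<omega> by (simp add: X_def st_def)
    show "U t \<omega> = c t * hist R (Suc t) \<omega> ! t + d t * hist R (Suc t) \<omega> ! (t - 1)" for t \<omega>
      by (simp add: U_def less_Suc_eq_le)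
  qed (simp_all add: X R Se Y_def Sr_def)
  then show ?thesis by blast
qed

lemma linear_form_nth: "s < n \<Longrightarrow> linear_form n (\<lambda>v. c * v ! s)"
  unfolding linear_form_def
  by (rule exI[of _ "\<lambda>k. if k = s then c else 0"]) (simp add: if_distrib[of "\<lambda>x. x * _"] cong: if_cong)

lemma linear_form_zero: "linear_form n (\<lambda>v. 0)"
  unfolding linear_form_def by (rule exI[of _ "\<lambda>k. 0"]) simp

lemma linear_form_add:
  assumes "linear_form n \<phi>" "linear_form n \<psi>"
  shows "linear_form n (\<lambda>v. \<phi> v + \<psi> v)"
proof -
  obtain c d where "\<forall>v. length v = n \<longrightarrow> \<phi> v = (\<Sum>s<n. c s * v ! s)"
    "\<forall>v. length v = n \<longrightarrow> \<psi> v = (\<Sum>s<n. d s * v ! s)"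
    using assms unfolding linear_form_def by blast
  then show ?thesis unfolding linear_form_def
    by (intro exI[of _ "\<lambda>s. c s + d s"]) (simp add: distrib_right sum.distrib)
qed

lemma linear_scheme_nth:
  "linear_scheme L (\<lambda>t x u. e t * x ! t) (\<lambda>i t y. if t = 0 then 0 else \<gamma> i * y ! (t - 1))
     (\<lambda>t r. c t * r ! t + d t * r ! (t - 1))"
  unfolding linear_scheme_def
proof (intro conjI allI impI)
  fix t
  show "\<exists>a b. linear_form (Suc t) a \<and> linear_form t b \<and>
     (\<forall>x u. length x = Suc t \<longrightarrow> length u = t \<longrightarrow> e t * x ! t = a x + b u)"
    by (rule exI[of _ "\<lambda>x. e t * x ! t"], rule exI[of _ "\<lambda>u. 0"])
      (auto intro: linear_form_nth linear_form_zero)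
  show "linear_form (Suc t) (\<lambda>r. c t * r ! t + d t * r ! (t - 1))"
    by (intro linear_form_add linear_form_nth) auto
  show "linear_form t (\<lambda>y. if t = 0 then 0 else \<gamma> i * y ! (t - 1))" for i
    by (cases t) (auto intro: linear_form_nth linear_form_zero)
qed

section \<open>Powers and stability for a fixed allocation\<close>

lemma (in two_phase_scheme) scheme_stabilizes:
  fixes M :: "'a measure" and B :: real and X0 :: "'a \<Rightarrow> real"
    and W Zd :: "nat \<Rightarrow> 'a \<Rightarrow> real" and Zr :: "nat \<Rightarrow> nat \<Rightarrow> 'a \<Rightarrow> real"
  assumes "prob_space M" and "B \<noteq> 0" and X0_sq: "integrable M (\<lambda>\<omega>. (X0 \<omega>)\<^sup>2)"
    and W: "\<forall>t. gaussian M Nw (W t)"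
    and Zd: "\<forall>t. gaussian M Nd (Zd t)"
    and Zr: "\<forall>i<L. \<forall>t. gaussian M (Nr i) (Zr i t)"
    and indep: "prob_space.indep_vars M (\<lambda>_. borel) (primitive X0 W Zr Zd) (sources L)"
    and rate: "log 2 \<bar>a\<bar> < 1 / 4 * (log 2 (1 + 2 * h\<^sup>2 * \<beta> * PS / Nd) +
     log 2 (1 + M_tilde L h hr PS Nr Nd \<beta> Pr / N_tilde L hr PS Nr Nd \<beta> Pr))"
  shows "\<exists>f g \<pi> X U Se Y Sr R.
           linear_scheme L f g \<pi> \<and>
           closed_loop a B L h hr X0 W Zr Zd f g \<pi> X U Se Y Sr R \<and>
           power_constraints M L PS \<beta> Pr Se Sr \<and>
           mean_square_stable M X"
proof -
  interpret prob_space M by fact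
  let ?Z = "primitive X0 W Zr Zd"
  define E0 where "E0 = expectation (\<lambda>\<omega>. (X0 \<omega>)\<^sup>2)"
  have E0: "0 \<le> E0" by (simp add: E0_def)
  have gauss: "gaussian M (source_var Nw Nd Nr j) (?Z j)" "0 < source_var Nw Nd Nr j" "j \<in> sources L"
    "j \<noteq> Initial" if "j \<in> future L 0" for j
    using that W Zd Zr Nw_pos Nd_pos Nr_pos by (auto simp: future_def sources_def)
  have second: "has_power M (?Z j) (source_var Nw Nd Nr j)" "expectation (?Z j) = 0"
    "integrable M (?Z j)" if "j \<in> future L 0" for j
    using gaussian_second_order[OF \<open>prob_space M\<close> gauss(1)[OF that] gauss(2)[OF that]] by auto
  have rv: "?Z j \<in> borel_measurable M" if "j \<in> sources L" for j
    using indep that by (auto simp: indep_vars_def)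
  have X0_rv: "X0 \<in> borel_measurable M" using rv[of Initial] by (simp add: sources_def)
  have X0_int: "integrable M X0" by (rule square_integrable_imp_integrable[OF X0_rv X0_sq])
  interpret orthogonal_noise M ?Z "source_var Nw Nd Nr" "future L 0"
  proof
    show "?Z j \<in> borel_measurable M" if "j \<in> future L 0" for j using rv gauss(3)[OF that] .
    show "has_power M (?Z j) (source_var Nw Nd Nr j)" if "j \<in> future L 0" for j using second(1)[OF that] .
    show "expectation (\<lambda>\<omega>. ?Z i \<omega> * ?Z j \<omega>) = 0"
      if "i \<in> future L 0" "j \<in> future L 0" "i \<noteq> j" for i j
      using that gauss second by (intro indep_vars_orthogonal[OF indep]) auto
  qed
  have base: "uncorr X0 E0 (future L 0)"
    unfolding uncorr_def
  proof (intro conjI ballI)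
    show "has_power M X0 E0" using X0_sq by (simp add: has_power_def E0_def)
    show "expectation (\<lambda>\<omega>. X0 \<omega> * ?Z j \<omega>) = 0" if "j \<in> future L 0" for j
      using indep_vars_orthogonal[OF indep, of Initial j] gauss[OF that] second[OF that] X0_int
      by (auto simp: sources_def)
  qed (use X0_rv in auto)

  \<comment> \<open>The scheme is silent at time 0, so \<open>X 1 = a * X0 + W 0\<close>, whose
    second moment starts the recursion.\<close>
  define v where "v = var_seq (a\<^sup>2 * E0 + Nw)"
  have v0_pos: "0 < a\<^sup>2 * E0 + Nw" using E0 Nw_pos by (intro add_nonneg_pos) auto
  have v_pos: "0 < v n" for n unfolding v_def by (rule var_seq_pos[OF v0_pos])
  \<comment> \<open>Times \<open>2 * n + 1\<close> and \<open>2 * n + 2\<close> both give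
    \<open>(t - 1) div 2 = n\<close>. The value 0 at \<open>t = 0\<close> omits the optional initial
    transmission.\<close>
  define e where "e t = (if t = 0 then 0 else if odd t then enc1 (v ((t - 1) div 2))
      else enc2 (v ((t - 1) div 2)))" for t
  \<comment> \<open>The factor \<open>- (a / B)\<close> makes \<open>B * U t\<close> equal to
    \<open>- a\<close> times the estimate, so that \<open>a\<close> times the estimation error
    remains.\<close>
  define c where "c t = (if t = 0 then 0 else if odd t then - (a / B) * est1 (v ((t - 1) div 2))
      else - (a / B) * est2 (v ((t - 1) div 2)))" for t
  \<comment> \<open>At even times this removes the predictable relayed part: \<open>est1\<close>
    times the previous observation estimates the previous state, and the relays carry it with gain
    \<open>relay_gain * enc1\<close>.\<close>
  define d where "d t = (if t = 0 \<or> odd t then 0 else (a / B) * est2 (v ((t - 1) div 2)) *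
      (relay_gain * enc1 (v ((t - 1) div 2)) * est1 (v ((t - 1) div 2))))" for t
  define f :: encoder where "f = (\<lambda>t x u. e t * x ! t)"
  define g :: relays where "g = (\<lambda>i t y. if t = 0 then 0 else amp i * y ! (t - 1))"
  define \<pi> :: controller where "\<pi> = (\<lambda>t r. c t * r ! t + d t * r ! (t - 1))"
  have "d 0 = 0" by (simp add: d_def)
  then have "\<exists>X U Se Y Sr R. closed_loop a B L h hr X0 W Zr Zd f g \<pi> X U Se Y Sr R"
    unfolding f_def g_def \<pi>_def by (rule closed_loop_exists)
  then obtain X U Se Y Sr R where
    loop: "closed_loop a B L h hr X0 W Zr Zd f g \<pi> X U Se Y Sr R"
    by (elim exE)
  have X_0: "X 0 = X0" and X_Suc: "X (Suc t) \<omega> = a * X t \<omega> + B * U t \<omega> + W t \<omega>"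
    and Se: "Se t \<omega> = e t * X t \<omega>"
    and Y: "i < L \<Longrightarrow> Y i t \<omega> = (if odd t then Se t \<omega> + Zr i t \<omega> else 0)"
    and Sr: "i < L \<Longrightarrow> Sr i t \<omega> = (if even t \<and> 0 < t then amp i * Y i (t - 1) \<omega> else 0)"
    and R: "R t \<omega> = h * Se t \<omega> + (\<Sum>i<L. hr i * Sr i t \<omega>) + Zd t \<omega>"
    and U: "U t \<omega> = c t * R t \<omega> + d t * R (t - 1) \<omega>" for t i \<omega>
    using loop by (auto simp: closed_loop_def f_def g_def \<pi>_def less_Suc_eq_le)

  \<comment> \<open>One odd and one even step, as an induction step: \<open>X t\<close> stays
    orthogonal to all noises from time \<open>t\<close> on.\<close>
  have step: "uncorr (X (Suc t)) (mid (v n)) (future L (Suc t))"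
      "uncorr (X (Suc (Suc t))) (v (Suc n)) (future L (Suc (Suc t)))"
    if t: "t = Suc (2 * n)" and X: "uncorr (X t) (v n) (future L t)" for t n
  proof -
    let ?v = "v n"
    \<comment> \<open>The estimation error \<open>X t - est1 ?v * R t\<close>, written in orthogonal
      terms.\<close>
    define V where "V \<omega> = rho * X t \<omega> - est1 ?v * Zd t \<omega>" for \<omega>
    have "uncorr (\<lambda>\<omega>. rho * X t \<omega> + (- est1 ?v) * ?Z (Dest t) \<omega>)
        (rho\<^sup>2 * ?v + (- est1 ?v)\<^sup>2 * source_var Nw Nd Nr (Dest t)) (future L t - {Dest t})"
      by (intro uncorr_add uncorr_scale X) (auto simp: future_def)
    then have V: "uncorr V (rho * ?v) (future L t - {Dest t})"
      using est1_error[OF v_pos[of n]] unfolding V_def by simp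
    have n: "(t - 1) div 2 = n" "t div 2 = n" "odd t" "0 < t" using t by auto
    have R_t: "R t \<omega> = h * enc1 ?v * X t \<omega> + Zd t \<omega>" for \<omega>
      using n by (simp add: R Se Sr e_def)
    have U_t: "U t \<omega> = - (a / B) * est1 ?v * R t \<omega>" for \<omega> using n by (simp add: U c_def d_def)
    have X1: "X (Suc t) \<omega> = a * V \<omega> + W t \<omega>" for \<omega>
    proof -
      have "X (Suc t) \<omega> = a * ((1 - est1 ?v * h * enc1 ?v) * X t \<omega> - est1 ?v * Zd t \<omega>) + W t \<omega>"
        unfolding X_Suc U_t R_t using \<open>B \<noteq> 0\<close> by (simp add: field_simps)
      then show ?thesis unfolding one_minus_est1[OF v_pos] V_def .
    qed
    have "uncorr (\<lambda>\<omega>. a * V \<omega> + 1 * ?Z (Plant t) \<omega>)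
        (a\<^sup>2 * (rho * ?v) + 1\<^sup>2 * source_var Nw Nd Nr (Plant t)) (future L t - {Dest t} - {Plant t})"
      by (intro uncorr_add uncorr_scale V) (auto simp: future_def)
    then have "uncorr (X (Suc t)) (mid ?v) (future L t - {Dest t} - {Plant t})"
      by (simp add: X1[abs_def] mid_def mult.assoc)
    then show "uncorr (X (Suc t)) (mid ?v) (future L (Suc t))"
      by (rule uncorr_mono) (auto simp: future_def)
    let ?c = "est2 ?v"
    let ?w = "1 - ?c * h * enc2 ?v"
    have R_1: "R (Suc t) \<omega> = h * enc2 ?v * X (Suc t) \<omega> + relay_gain * enc1 ?v * X t \<omega>
        + (\<Sum>i<L. hr i * amp i * Zr i t \<omega>) + Zd (Suc t) \<omega>" for \<omega>
    proof -
      have "(\<Sum>i<L. hr i * Sr i (Suc t) \<omega>)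
          = (\<Sum>i<L. hr i * amp i * (enc1 ?v * X t \<omega>) + hr i * amp i * Zr i t \<omega>)"
        using n by (intro sum.cong) (auto simp: Sr Y Se e_def algebra_simps)
      also have "\<dots> = relay_gain * enc1 ?v * X t \<omega> + (\<Sum>i<L. hr i * amp i * Zr i t \<omega>)"
        by (simp add: sum.distrib relay_gain_def sum_distrib_right mult.assoc)
      finally show ?thesis using n by (simp add: R Se e_def)
    qed
    have U_1: "U (Suc t) \<omega> = - (a / B) * ?c * (R (Suc t) \<omega> - relay_gain * enc1 ?v * est1 ?v * R t \<omega>)" for \<omega>
      using n by (simp add: U c_def d_def algebra_simps)
    \<comment> \<open>Subtracting the prediction replaces \<open>X t\<close> in the relayed part by
      its error \<open>V\<close>, the same variable that drives \<open>X (Suc t)\<close>.\<close>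
    have innovation: "R (Suc t) \<omega> - relay_gain * enc1 ?v * est1 ?v * R t \<omega>
        = h * enc2 ?v * X (Suc t) \<omega> + relay_gain * enc1 ?v * V \<omega>
          + (\<Sum>i<L. hr i * amp i * Zr i t \<omega>) + Zd (Suc t) \<omega>" for \<omega>
      unfolding R_1 R_t V_def one_minus_est1[OF v_pos[of n], symmetric] by (simp add: algebra_simps)
    \<comment> \<open>\<open>X (Suc t)\<close> and \<open>V\<close> are in general correlated, so
      their powers cannot be added. Inserting \<open>X (Suc t) = a * V + W t\<close> leaves
      \<open>V\<close> and noises that each occur once.\<close>
    have X2: "X (Suc (Suc t)) \<omega> = a * (a - ?c * sig ?v) * V \<omega> + a * ?w * W t \<omega>
        + (\<Sum>i<L. (- a * ?c * (hr i * amp i)) * Zr i t \<omega>) + (- a * ?c) * Zd (Suc t) \<omega>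
        + 1 * W (Suc t) \<omega>" for \<omega>
    proof -
      have "X (Suc (Suc t)) \<omega> = a * (X (Suc t) \<omega>
          - ?c * (h * enc2 ?v * X (Suc t) \<omega> + relay_gain * enc1 ?v * V \<omega>
          + (\<Sum>i<L. hr i * amp i * Zr i t \<omega>) + Zd (Suc t) \<omega>)) + W (Suc t) \<omega>"
        unfolding X_Suc[of "Suc t"] U_1 innovation using \<open>B \<noteq> 0\<close> by (simp add: field_simps)
      moreover have "(\<Sum>i<L. (- a * ?c * (hr i * amp i)) * Zr i t \<omega>)
          = (- a * ?c) * (\<Sum>i<L. hr i * amp i * Zr i t \<omega>)"
        by (simp add: sum_distrib_left mult.assoc)
      ultimately show ?thesis unfolding X1 sig_def by (simp add: algebra_simps)
    qed
    \<comment> \<open>The differences follow the order in which the noises are added, the first one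
      having entered through \<open>V\<close>.\<close>
    let ?J = "future L t - {Dest t} - {Plant t} - (\<lambda>i. Relay i t) ` {..<L} - {Dest (Suc t)} - {Plant (Suc t)}"
    have "uncorr (\<lambda>\<omega>. a * (a - ?c * sig ?v) * V \<omega> + a * ?w * ?Z (Plant t) \<omega>
        + (\<Sum>i<L. (- a * ?c * (hr i * amp i)) * ?Z (Relay i t) \<omega>) + (- a * ?c) * ?Z (Dest (Suc t)) \<omega>
        + 1 * ?Z (Plant (Suc t)) \<omega>)
      ((a * (a - ?c * sig ?v))\<^sup>2 * (rho * ?v) + (a * ?w)\<^sup>2 * source_var Nw Nd Nr (Plant t)
        + (\<Sum>i<L. (- a * ?c * (hr i * amp i))\<^sup>2 * source_var Nw Nd Nr (Relay i t))
        + (- a * ?c)\<^sup>2 * source_var Nw Nd Nr (Dest (Suc t))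
        + 1\<^sup>2 * source_var Nw Nd Nr (Plant (Suc t))) ?J"
      by (intro uncorr_add uncorr_sum uncorr_scale V) (auto simp: future_def inj_on_def)
    moreover have "(a * (a - ?c * sig ?v))\<^sup>2 * (rho * ?v) + (a * ?w)\<^sup>2 * source_var Nw Nd Nr (Plant t)
        + (\<Sum>i<L. (- a * ?c * (hr i * amp i))\<^sup>2 * source_var Nw Nd Nr (Relay i t))
        + (- a * ?c)\<^sup>2 * source_var Nw Nd Nr (Dest (Suc t))
        + 1\<^sup>2 * source_var Nw Nd Nr (Plant (Suc t)) = next_var ?v"
    proof -
      have "(\<Sum>i<L. (- a * ?c * (hr i * amp i))\<^sup>2 * Nr i) = a\<^sup>2 * ?c\<^sup>2 * (\<Sum>i<L. (hr i * amp i)\<^sup>2 * Nr i)"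
        by (simp add: sum_distrib_left power_mult_distrib mult.assoc)
      then show ?thesis unfolding next_var_def noise_eq
        by (simp add: power_mult_distrib distrib_left mult.assoc)
    qed
    ultimately have "uncorr (X (Suc (Suc t))) (next_var ?v) ?J"
      by (simp add: X2[abs_def])
    then show "uncorr (X (Suc (Suc t))) (v (Suc n)) (future L (Suc (Suc t)))"
      unfolding v_def by simp (erule uncorr_mono, auto simp: future_def)
  qed

  have X1: "uncorr (X (Suc 0)) (v 0) (future L (Suc 0))"
  proof -
    have "uncorr (\<lambda>\<omega>. a * X0 \<omega> + 1 * ?Z (Plant 0) \<omega>) (a\<^sup>2 * E0 + 1\<^sup>2 * source_var Nw Nd Nr (Plant 0))
        (future L 0 - {Plant 0})"
      by (intro uncorr_add uncorr_scale base) (auto simp: future_def)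
    moreover have "X (Suc 0) = (\<lambda>\<omega>. a * X0 \<omega> + W 0 \<omega>)"
      by (rule ext) (simp add: X_Suc U c_def d_def X_0)
    ultimately have "uncorr (X (Suc 0)) (v 0) (future L 0 - {Plant 0})"
      by (simp add: v_def)
    then show ?thesis by (rule uncorr_mono) (auto simp: future_def)
  qed
  have odd_X: "uncorr (X (Suc (2 * n))) (v n) (future L (Suc (2 * n)))" for n
  proof (induction n)
    case (Suc n)
    then show ?case using step(2)[OF refl Suc] by simp
  qed (use X1 in simp)
  have even_X: "uncorr (X (Suc (Suc (2 * n)))) (mid (v n)) (future L (Suc (Suc (2 * n))))" for n
    using step(1)[OF refl odd_X] .

  have Se_fun: "Se t = (\<lambda>\<omega>. e t * X t \<omega>)" for t using Se by auto
  \<comment> \<open>More than the power is recorded: orthogonality to the relay noise is what makes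
    the power heard by a relay \<open>2 * \<beta> * PS + Nr i\<close>.\<close>
  have Se_odd: "uncorr (Se t) (2 * \<beta> * PS) (future L t)" if "odd t" for t
  proof -
    obtain n where t: "t = Suc (2 * n)" using \<open>odd t\<close> by (auto elim: oddE)
    show ?thesis
      using uncorr_scale[OF odd_X[of n], of "e t"] enc1_sq[OF v_pos[of n]]
      by (simp add: Se_fun t e_def)
  qed
  have even_form: "\<exists>n. t = Suc (Suc (2 * n))" if "even t" "0 < t" for t :: nat
    using that by (auto elim!: evenE) (metis Suc_pred mult_Suc_right add_2_eq_Suc)
  have "has_power M (Se t) (2 * (1 - \<beta>) * PS)" if "even t" "0 < t" for t
  proof -
    obtain n where t: "t = Suc (Suc (2 * n))" using even_form[OF \<open>even t\<close> \<open>0 < t\<close>] by blast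
    show ?thesis
      using has_power_scale[OF uncorr_has_power[OF even_X[of n]], of "e t"]
        enc2_sq[of "v n"] v_pos[of n] by (simp add: Se_fun t e_def)
  qed
  moreover have "has_power M (Sr i t) (2 * Pr i)" if "i < L" "even t" "0 < t" for i t
  proof -
    have odd: "odd (t - 1)" using that by auto
    have "uncorr (\<lambda>\<omega>. Se (t - 1) \<omega> + 1 * ?Z (Relay i (t - 1)) \<omega>)
      (2 * \<beta> * PS + 1\<^sup>2 * source_var Nw Nd Nr (Relay i (t - 1))) (future L (t - 1) - {Relay i (t - 1)})"
      using \<open>i < L\<close> by (intro uncorr_add Se_odd odd) (auto simp: future_def)
    from has_power_scale[OF uncorr_has_power[OF this], of "amp i"]
    have "has_power M (\<lambda>\<omega>. amp i * (Se (t - 1) \<omega> + Zr i (t - 1) \<omega>)) (2 * Pr i)"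
      using amp_sq[OF \<open>i < L\<close>] by simp
    moreover have "Sr i t = (\<lambda>\<omega>. amp i * (Se (t - 1) \<omega> + Zr i (t - 1) \<omega>))"
      using that odd by (intro ext) (simp add: Sr Y)
    ultimately show ?thesis by simp
  qed
  moreover have "has_power M (Se 0) 0" by (simp add: has_power_def Se e_def)
  ultimately have power: "power_constraints M L PS \<beta> Pr Se Sr"
    using uncorr_has_power[OF Se_odd] by (simp add: power_constraints_def)

  obtain K where K: "v n \<le> K" for n
    using var_seq_bounded[OF v0_pos rate] unfolding v_def by blast
  \<comment> \<open>Covers time 0, odd times and even times; \<open>mid\<close> is monotone.\<close>
  define K' where "K' = max E0 (max K (mid K))"
  have "\<exists>q. has_power M (X t) q \<and> q \<le> K'" for t
  proof (cases "t = 0")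
    case True
    then show ?thesis using uncorr_has_power[OF base] by (auto simp: X_0 K'_def)
  next
    case False
    show ?thesis
    proof (cases "odd t")
      case True
      then obtain n where "t = Suc (2 * n)" by (auto elim: oddE)
      then show ?thesis using uncorr_has_power[OF odd_X[of n]] K[of n] by (auto simp: K'_def)
    next
      case False
      then obtain n where t: "t = Suc (Suc (2 * n))" using even_form[of t] \<open>t \<noteq> 0\<close> by auto
      have "mid (v n) \<le> mid K" using K[of n] rho_pos by (auto simp: mid_def intro!: mult_left_mono)
      then show ?thesis using uncorr_has_power[OF even_X[of n]] unfolding t by (auto simp: K'_def)
    qed
  qed
  then have "integrable M (\<lambda>\<omega>. (X t \<omega>)\<^sup>2) \<and> expectation (\<lambda>\<omega>. (X t \<omega>)\<^sup>2) < K' + 1" for t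
    unfolding has_power_def by (metis le_less_trans less_add_one)
  then have "mean_square_stable M X" unfolding mean_square_stable_def by blast
  moreover have "linear_scheme L f g \<pi>" unfolding f_def g_def \<pi>_def by (rule linear_scheme_nth)
  ultimately show ?thesis using loop power by blast
qed

theorem theorem5p2:
  fixes M :: "'a measure"
    and a B h PS PR Nw Nd :: real
    and L :: nat
    and hr Nr :: "nat \<Rightarrow> real"
    and X0 :: "'a \<Rightarrow> real"
    and W Zd :: "nat \<Rightarrow> 'a \<Rightarrow> real"
    and Zr :: "nat \<Rightarrow> nat \<Rightarrow> 'a \<Rightarrow> real"
  assumes "prob_space M"
    and "1 \<le> \<bar>a\<bar>" and "B \<noteq> 0"
    and "0 \<le> PS" and "0 \<le> PR"
    and "0 < Nw" and "0 < Nd" and "\<forall>i<L. 0 < Nr i"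
    and "finite_diff_entropy M X0" and "integrable M (\<lambda>\<omega>. (X0 \<omega>)\<^sup>2)"
    and "\<forall>t. gaussian M Nw (W t)"
    and "\<forall>t. gaussian M Nd (Zd t)"
    and "\<forall>i<L. \<forall>t. gaussian M (Nr i) (Zr i t)"
    and "prob_space.indep_vars M (\<lambda>_. borel) (primitive X0 W Zr Zd) (sources L)"
    and "log 2 \<bar>a\<bar> < 1 / 4 *
           (SUP (\<beta>, Pr) \<in> allocations L PR.
              log 2 (1 + 2 * h\<^sup>2 * \<beta> * PS / Nd) +
              log 2 (1 + M_tilde L h hr PS Nr Nd \<beta> Pr / N_tilde L hr PS Nr Nd \<beta> Pr))"
  shows "\<exists>\<beta> Pr f g \<pi> X U Se Y Sr R.
           (\<beta>, Pr) \<in> allocations L PR \<and>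
           linear_scheme L f g \<pi> \<and>
           closed_loop a B L h hr X0 W Zr Zd f g \<pi> X U Se Y Sr R \<and>
           power_constraints M L PS \<beta> Pr Se Sr \<and>
           mean_square_stable M X"
proof -
  interpret prob_space M by fact
  define rate where "rate = (\<lambda>(\<beta>, Pr). log 2 (1 + 2 * h\<^sup>2 * \<beta> * PS / Nd) +
      log 2 (1 + M_tilde L h hr PS Nr Nd \<beta> Pr / N_tilde L hr PS Nr Nd \<beta> Pr))"
  \<comment> \<open>A nonempty set of allocations lets a strict inequality below the supremum be
    witnessed by a single allocation, whether or not a maximum is attained.\<close>
  have "(1, \<lambda>_. 0) \<in> allocations L PR" using assms(5) by (simp add: allocations_def)
  then have nonempty: "rate ` allocations L PR \<noteq> {}" by blast
  have "4 * log 2 \<bar>a\<bar> < Sup (rate ` allocations L PR)"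
    using assms(15) by (simp add: rate_def)
  \<comment> \<open>If the image is not bounded above, \<open>Sup\<close> is unspecified, but then the claim is trivial.\<close>
  then have "\<exists>p\<in>allocations L PR. 4 * log 2 \<bar>a\<bar> < rate p"
    using less_cSup_iff[OF nonempty, of "4 * log 2 \<bar>a\<bar>"]
    by (cases "bdd_above (rate ` allocations L PR)") (auto simp: bdd_above_def not_le)
  then obtain \<beta> Pr where alloc: "(\<beta>, Pr) \<in> allocations L PR"
    and "4 * log 2 \<bar>a\<bar> < rate (\<beta>, Pr)" by auto
  then have gap: "log 2 \<bar>a\<bar> < 1 / 4 * (log 2 (1 + 2 * h\<^sup>2 * \<beta> * PS / Nd) +
      log 2 (1 + M_tilde L h hr PS Nr Nd \<beta> Pr / N_tilde L hr PS Nr Nd \<beta> Pr))"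
    by (simp add: rate_def)
  interpret two_phase_scheme a h PS Nw Nd \<beta> L hr Nr Pr
    using assms alloc by unfold_locales (auto simp: allocations_def)
  show ?thesis
    using scheme_stabilizes[OF assms(1,3,10-14) gap] alloc by blast
qed

end
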